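(* Let $\mathcal P$ be the Petersen graph on the vertex set $H=\{a_1,a_2,a_3,b_1,b_2,\tilde b_3,c_2,c_3,c_4,c_5\}$ with the $15$ edges $c_4c_2,\ c_2\tilde b_3,\ \tilde b_3a_1,\ a_1c_5,\ c_5c_4$ (outer cycle), $c_4c_3,\ c_2a_3,\ \tilde b_3b_2,\ a_1a_2,\ c_5b_1$ (spokes), $c_3b_2,\ b_2b_1,\ b_1a_3,\ a_3a_2,\ a_2c_3$ (inner pentagram). Write $a\sim b$ for adjacency. In $\mathbb{Q}[\beta,\ell_b : b\in H]$ let $\mathcal I$ be the ideal generated by the ten linear forms $\ell_b-\sum_{a\sim b}\ell_a$ ($b\in H$). Put $u_b^{\pm}=\tfrac12(\ell_b\pm\beta)$, for $J\subseteq H$ put $X^J:=\prod_{b\notin J}u_b^+\prod_{b\in J}u_b^-$, and let $$F:=7X^{\emptyset}-2\sum_{b\in H}X^{\{b\}}+\sum_{\{a,b\}\text{ edge of }\mathcal P}X^{\{a,b\}}.$$ Let $C$ be the ring automorphism with $C(\ell_b)=-\ell_b$ for all $b$ and $C(\beta)=\beta$ (it preserves $\mathcal I$). Then $C(F)-F\in\mathcal I$, i.e. the image of $F$ in $\mathbb{Q}[\beta,\ell]/\mathcal I$ is invariant under $C$.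
   Context: This encodes the paper's "Jack Littlewood–Richardson polynomial" for the triple of partitions $(21,21,321)$: the ten vertices label boxes of this triple (with $\tilde b_3$ a virtual box combining $b_3\in\nu$ and $c_1,c_6\in\lambda$), $u_b^+$ is the (signed) $\alpha$-hook symbol of box $b$ chosen in a fixed reference Stanley diagram $X$ and $u_b^-$ the (signed) opposite hook, with $\beta$ a formal variable evaluating to $\alpha-1$; $F$ is the 26-term Stanley sum $7X-2\sum_b X^{\{b\}}+\sum_{\text{edges}}X^{\{a,b\}}$ written in these variables, and $\mathbb{Q}[\beta,\ell]/\mathcal I$ is the "hook space" in which it is considered. *)

theory Defs
  imports Complex_Main "HOL-Library.Poly_Mapping"
begin

(* B3 is the virtual box written b_3 with a tilde. *)
datatype vertex = A1 | A2 | A3 | B1 | B2 | B3 | C2 | C3 | C4 | C5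

lemma UNIV_vertex: "(UNIV :: vertex set) = {A1, A2, A3, B1, B2, B3, C2, C3, C4, C5}"
proof -
  have "v \<in> {A1, A2, A3, B1, B2, B3, C2, C3, C4, C5}" for v :: vertex
    by (cases v) simp_all
  then show ?thesis by blast
qed

instance vertex :: finite
  by standard (simp add: UNIV_vertex)

definition petersen_edges :: "vertex set set" where
  "petersen_edges =
    {{C4, C2}, {C2, B3}, {B3, A1}, {A1, C5}, {C5, C4},
     {C4, C3}, {C2, A3}, {B3, B2}, {A1, A2}, {C5, B1},
     {C3, B2}, {B2, B1}, {B1, A3}, {A3, A2}, {A2, C3}}"

definition adj :: "vertex \<Rightarrow> vertex \<Rightarrow> bool" (infix \<open>\<sim>\<close> 50) where
  "a \<sim> b \<longleftrightarrow> {a, b} \<in> petersen_edges"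

datatype indet = Beta | Ell vertex

(* Multivariate polynomials as finitely supported maps from monomials
   (finitely supported exponent vectors) to coefficients; multiplication
   on poly_mapping is convolution. *)
type_synonym hook_poly = "(indet \<Rightarrow>\<^sub>0 nat) \<Rightarrow>\<^sub>0 rat"

definition Const :: "rat \<Rightarrow> hook_poly" where
  "Const c = Poly_Mapping.single 0 c"

definition Var :: "indet \<Rightarrow> hook_poly" where
  "Var x = Poly_Mapping.single (Poly_Mapping.single x 1) 1"

abbreviation beta :: hook_poly where
  "beta \<equiv> Var Beta"

abbreviation ell :: "vertex \<Rightarrow> hook_poly" where
  "ell b \<equiv> Var (Ell b)"

(* The ideal generated by S is the span of S in the ring as a module over itself. *)
definition ideal_generated :: "'a::comm_ring_1 set \<Rightarrow> 'a set" where
  "ideal_generated S = module.span (*) S"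

definition hook_ideal :: "hook_poly set" where
  "hook_ideal = ideal_generated (range (\<lambda>b. ell b - (\<Sum>a | a \<sim> b. ell a)))"

definition u_plus :: "vertex \<Rightarrow> hook_poly" where
  "u_plus b = Const (1/2) * (ell b + beta)"

definition u_minus :: "vertex \<Rightarrow> hook_poly" where
  "u_minus b = Const (1/2) * (ell b - beta)"

definition X :: "vertex set \<Rightarrow> hook_poly" where
  "X J = (\<Prod>b\<in>-J. u_plus b) * (\<Prod>b\<in>J. u_minus b)"

definition F :: hook_poly where
  "F = 7 * X {} - 2 * (\<Sum>b\<in>UNIV. X {b}) + (\<Sum>e\<in>petersen_edges. X e)"

definition ring_automorphism :: "('a::comm_ring_1 \<Rightarrow> 'a) \<Rightarrow> bool" where
  "ring_automorphism h \<longleftrightarrow>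
     bij h \<and> h 1 = 1 \<and> (\<forall>p q. h (p + q) = h p + h q) \<and> (\<forall>p q. h (p * q) = h p * h q)"

lemma card_petersen_edges: "card petersen_edges = 15"
  by (simp add: petersen_edges_def doubleton_eq_iff)

lemma ideal_generated_minimal:
  "ideal_generated S = \<Inter>{I. S \<subseteq> I \<and> 0 \<in> I \<and> (\<forall>p\<in>I. \<forall>q\<in>I. p + q \<in> I) \<and> (\<forall>r. \<forall>p\<in>I. r * p \<in> I)}"
proof -
  interpret M: module "(*) :: 'a \<Rightarrow> 'a \<Rightarrow> 'a"
    by standard (simp_all add: algebra_simps)
  show ?thesis
    unfolding ideal_generated_def M.span_def hull_def M.subspace_def
    by (rule arg_cong[where f = Inter]) blast
qed

(* ell_sign, sign_map and the facts about them only serve to show that the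
   automorphism with beta fixed and each ell b negated exists. *)
definition ell_sign :: "(indet \<Rightarrow>\<^sub>0 nat) \<Rightarrow> rat" where
  "ell_sign m = (-1) ^ (\<Sum>b\<in>UNIV. Poly_Mapping.lookup m (Ell b))"

lemma ell_sign_add: "ell_sign (m + n) = ell_sign m * ell_sign n"
  by (simp add: ell_sign_def lookup_add sum.distrib power_add)

lemma ell_sign_sq: "ell_sign m * ell_sign m = 1"
  by (simp add: ell_sign_def flip: power_mult_distrib)

definition sign_map :: "hook_poly \<Rightarrow> hook_poly" where
  "sign_map = Poly_Mapping.mapp (\<lambda>m c. ell_sign m * c)"

lemma lookup_sign_map:
  "Poly_Mapping.lookup (sign_map p) m = ell_sign m * Poly_Mapping.lookup p m"
  by (simp add: sign_map_def lookup_mapp when_def in_keys_iff)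

lemma sign_map_add: "sign_map (p + q) = sign_map p + sign_map q"
  by (rule poly_mapping_eqI) (simp add: lookup_sign_map lookup_add algebra_simps)

lemma sign_map_zero: "sign_map 0 = 0"
  by (rule poly_mapping_eqI) (simp add: lookup_sign_map)

lemma sign_map_single:
  "sign_map (Poly_Mapping.single m c) = Poly_Mapping.single m (ell_sign m * c)"
  by (rule poly_mapping_eqI) (simp add: lookup_sign_map lookup_single when_def)

lemma hook_poly_induct [case_names zero add]:
  fixes p :: hook_poly
  assumes "P 0" and "\<And>m c p. P p \<Longrightarrow> P (Poly_Mapping.single m c + p)"
  shows "P p"
proof (induction p rule: update_induct)
  case const
  then show ?case using assms(1) by simp
next
  case (update p m c)
  have "Poly_Mapping.update m c p = Poly_Mapping.single m c + p"
    using update(1) by (intro poly_mapping_eqI)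
      (auto simp: lookup_update lookup_add lookup_single when_def in_keys_iff)
  then show ?case using assms(2) update by simp
qed

lemma sign_map_mult: "sign_map (p * q) = sign_map p * sign_map q"
proof (induction p rule: hook_poly_induct)
  case zero
  then show ?case by (simp add: sign_map_zero)
next
  case (add m c p)
  have "sign_map (Poly_Mapping.single m c * q) = sign_map (Poly_Mapping.single m c) * sign_map q"
  proof (induction q rule: hook_poly_induct)
    case zero
    then show ?case by (simp add: sign_map_zero)
  next
    case (add n d q)
    then show ?case
      by (simp add: distrib_left sign_map_add sign_map_single mult_single ell_sign_add ac_simps)
  qed
  with add show ?case by (simp add: distrib_right sign_map_add)
qed

lemma ex_sign_automorphism:
  "\<exists>C. ring_automorphism C \<and> (\<forall>b. C (ell b) = - ell b) \<and> C beta = beta"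
proof -
  have "sign_map (sign_map p) = p" for p
    by (rule poly_mapping_eqI) (simp add: lookup_sign_map ell_sign_sq flip: mult.assoc)
  then have "bij sign_map"
    by (metis bijI')
  moreover have "sign_map 1 = 1"
    by (simp add: sign_map_single ell_sign_def flip: single_one)
  moreover have "sign_map (ell b) = - ell b" for b
    by (simp add: Var_def sign_map_single ell_sign_def lookup_single when_def single_uminus)
  moreover have "sign_map beta = beta"
    by (simp add: Var_def sign_map_single ell_sign_def lookup_single when_def)
  ultimately show ?thesis
    by (intro exI[of _ sign_map]) (simp add: ring_automorphism_def sign_map_add sign_map_mult)
qed

end

theory Submission
  imports Defs
begin

text \<open>
  Since \<^term>\<open>C\<close> sends the two factors at a vertex to the negatives of each other and there are ten
  vertices, \<^term>\<open>C\<close> acts on the Stanley sum by exchanging the two families of factors. Modulo the ideal,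
  the five generators belonging to the outer cycle express every inner variable through the outer
  ones, so the claim becomes a polynomial identity in \<^term>\<open>beta\<close> and the five outer variables.
\<close>

section \<open>Integrality of the polynomial ring\<close>

text \<open>
  A linear order on the indeterminates makes the monomials an ordered monoid, which is what the
  library needs to recognise the polynomial ring as an integral domain.
\<close>

fun vertex_rank :: "vertex \<Rightarrow> nat" where
  "vertex_rank A1 = 1" | "vertex_rank A2 = 2" | "vertex_rank A3 = 3" | "vertex_rank B1 = 4"
| "vertex_rank B2 = 5" | "vertex_rank B3 = 6" | "vertex_rank C2 = 7" | "vertex_rank C3 = 8"
| "vertex_rank C4 = 9" | "vertex_rank C5 = 10"

text \<open>The vertex ranks start at 1, which leaves 0 for \<open>Beta\<close> and keeps the
  ranking injective, as antisymmetry of the induced order requires.\<close>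

fun indet_rank :: "indet \<Rightarrow> nat" where
  "indet_rank Beta = 0"
| "indet_rank (Ell b) = vertex_rank b"

lemma indet_rank_inject: "indet_rank x = indet_rank y \<longleftrightarrow> x = y"
proof -
  have "vertex_rank a = vertex_rank b \<longleftrightarrow> a = b" for a b
    by (cases a; cases b) simp_all
  moreover have "vertex_rank a \<noteq> 0" for a
    by (cases a) simp_all
  ultimately show ?thesis
    by (cases x; cases y) (simp_all add: eq_commute[of 0])
qed

instantiation indet :: linorder
begin

definition less_eq_indet :: "indet \<Rightarrow> indet \<Rightarrow> bool" where
  "less_eq_indet x y \<longleftrightarrow> indet_rank x \<le> indet_rank y"

definition less_indet :: "indet \<Rightarrow> indet \<Rightarrow> bool" where
  "less_indet x y \<longleftrightarrow> indet_rank x < indet_rank y"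

instance
  by standard (auto simp: less_eq_indet_def less_indet_def simp flip: indet_rank_inject)

end

section \<open>The Stanley sum\<close>

text \<open>The two families of factors are parameters, so that \<open>F\<close>, its image under
  \<open>C\<close> and their reductions modulo the ideal are all instances of one
  expression.\<close>

definition stanley_term :: "(vertex \<Rightarrow> 'a) \<Rightarrow> (vertex \<Rightarrow> 'a) \<Rightarrow> vertex set \<Rightarrow> 'a::comm_ring_1" where
  "stanley_term p m J = (\<Prod>b\<in>UNIV. if b \<in> J then m b else p b)"

definition stanley_sum :: "(vertex \<Rightarrow> 'a) \<Rightarrow> (vertex \<Rightarrow> 'a) \<Rightarrow> 'a::comm_ring_1" where
  "stanley_sum p m =
     7 * stanley_term p m {} - 2 * (\<Sum>b\<in>UNIV. stanley_term p m {b})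
       + (\<Sum>e\<in>petersen_edges. stanley_term p m e)"

lemma X_eq_stanley_term: "X J = stanley_term u_plus u_minus J"
proof -
  have "stanley_term u_plus u_minus J =
      (\<Prod>b\<in>UNIV \<inter> {b. b \<in> J}. u_minus b) * (\<Prod>b\<in>UNIV \<inter> - {b. b \<in> J}. u_plus b)"
    unfolding stanley_term_def by (rule prod.If_cases) simp
  then show ?thesis
    by (simp add: X_def mult.commute)
qed

lemma F_eq_stanley_sum: "F = stanley_sum u_plus u_minus"
  by (simp add: F_def stanley_sum_def X_eq_stanley_term)

lemma card_UNIV_vertex: "card (UNIV :: vertex set) = 10"
  by (simp add: UNIV_vertex)

lemma stanley_term_scale:
  "stanley_term (\<lambda>b. c * p b) (\<lambda>b. c * m b) J = c ^ 10 * stanley_term p m J"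
proof -
  have "stanley_term (\<lambda>b. c * p b) (\<lambda>b. c * m b) J =
      (\<Prod>b\<in>UNIV. c * (if b \<in> J then m b else p b))"
    unfolding stanley_term_def by (intro prod.cong) simp_all
  then show ?thesis
    by (simp add: prod.distrib card_UNIV_vertex stanley_term_def)
qed

text \<open>Every term has one factor per vertex, so the sum is homogeneous of degree 10. This
  serves both for c = 1/2, from the definition of the hooks, and for c = -1, from the action of
  \<open>C\<close>.\<close>

lemma stanley_sum_scale:
  "stanley_sum (\<lambda>b. c * p b) (\<lambda>b. c * m b) = c ^ 10 * stanley_sum p m"
  by (simp add: stanley_sum_def stanley_term_scale algebra_simps flip: sum_distrib_left sum_distrib_right)

lemma sum_petersen_edges:
  fixes f :: "vertex set \<Rightarrow> 'a::comm_ring_1"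
  shows "sum f petersen_edges =
    f {C4, C2} + (f {C2, B3} + (f {B3, A1} + (f {A1, C5} + (f {C5, C4} +
    (f {C4, C3} + (f {C2, A3} + (f {B3, B2} + (f {A1, A2} + (f {C5, B1} +
    (f {C3, B2} + (f {B2, B1} + (f {B1, A3} + (f {A3, A2} + f {A2, C3})))))))))))))"
  by (simp add: petersen_edges_def doubleton_eq_iff)

lemma sum_UNIV_vertex:
  fixes f :: "vertex \<Rightarrow> 'a::comm_ring_1"
  shows "sum f UNIV =
    f A1 + (f A2 + (f A3 + (f B1 + (f B2 + (f B3 + (f C2 + (f C3 + (f C4 + f C5))))))))"
  by (simp add: UNIV_vertex)

lemma prod_UNIV_vertex:
  fixes f :: "vertex \<Rightarrow> 'a::comm_ring_1"
  shows "prod f UNIV =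
    f A1 * (f A2 * (f A3 * (f B1 * (f B2 * (f B3 * (f C2 * (f C3 * (f C4 * f C5))))))))"
  by (simp add: UNIV_vertex)

text \<open>Exchanging the families means replacing t by -t, so the claim is that the odd powers of
  t cancel. The assumptions are the relations at the five outer vertices, solved for the inner
  ones.\<close>

lemma stanley_sum_swap:
  fixes x :: "vertex \<Rightarrow> 'a::idom"
  assumes "x C3 = x C4 - x C2 - x C5" "x A3 = x C2 - x C4 - x B3" "x B2 = x B3 - x C2 - x A1"
    "x A2 = x A1 - x B3 - x C5" "x B1 = x C5 - x A1 - x C4"
  shows "stanley_sum (\<lambda>b. x b + t) (\<lambda>b. x b - t) = stanley_sum (\<lambda>b. x b - t) (\<lambda>b. x b + t)"
proof -
  \<comment> \<open>With names for the outer values, full expansion leaves a polynomial identity in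
    six free variables.\<close>
  obtain a b c d e where outer: "x C4 = a" "x C2 = b" "x B3 = c" "x A1 = d" "x C5 = e"
    by simp
  show ?thesis
    by (simp only: stanley_sum_def stanley_term_def sum_petersen_edges sum_UNIV_vertex
        prod_UNIV_vertex insert_iff empty_iff vertex.distinct simp_thms if_True if_False
        assms outer) algebra
qed

section \<open>The hook ideal\<close>

interpretation ring_module: module "(*) :: 'a \<Rightarrow> 'a \<Rightarrow> 'a::comm_ring_1"
  by standard (simp_all add: algebra_simps)

text \<open>Equality in the hook space, expressed on representatives instead of in a quotient
  type.\<close>

definition ideal_cong :: "hook_poly \<Rightarrow> hook_poly \<Rightarrow> bool" (infix \<open>\<approx>\<close> 50) where
  "p \<approx> q \<longleftrightarrow> p - q \<in> hook_ideal"

lemma hook_ideal_zero: "0 \<in> hook_ideal"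
  unfolding hook_ideal_def ideal_generated_def by (rule ring_module.span_zero)

lemma hook_ideal_add: "p \<in> hook_ideal \<Longrightarrow> q \<in> hook_ideal \<Longrightarrow> p + q \<in> hook_ideal"
  unfolding hook_ideal_def ideal_generated_def by (rule ring_module.span_add)

lemma hook_ideal_mult: "p \<in> hook_ideal \<Longrightarrow> r * p \<in> hook_ideal"
  unfolding hook_ideal_def ideal_generated_def by (rule ring_module.span_scale)

lemma hook_ideal_generator: "ell b - (\<Sum>a | a \<sim> b. ell a) \<in> hook_ideal"
  unfolding hook_ideal_def ideal_generated_def by (rule ring_module.span_base) simp

lemma ideal_cong_refl: "p \<approx> p"
  by (simp add: ideal_cong_def hook_ideal_zero)

lemma ideal_cong_sym:
  assumes "p \<approx> q"
  shows "q \<approx> p"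
  using hook_ideal_mult[of "p - q" "-1"] assms by (simp add: ideal_cong_def)

lemma ideal_cong_trans:
  assumes "p \<approx> q" "q \<approx> r"
  shows "p \<approx> r"
  using hook_ideal_add[of "p - q" "q - r"] assms by (simp add: ideal_cong_def)

lemma ideal_cong_add:
  assumes "p \<approx> q" "p' \<approx> q'"
  shows "p + p' \<approx> q + q'"
  using hook_ideal_add[of "p - q" "p' - q'"] assms by (simp add: ideal_cong_def algebra_simps)

lemma ideal_cong_mult:
  assumes "p \<approx> q" "p' \<approx> q'"
  shows "p * p' \<approx> q * q'"
proof -
  have "p' * (p - q) + q * (p' - q') \<in> hook_ideal"
    using assms by (simp add: ideal_cong_def hook_ideal_add hook_ideal_mult)
  then show ?thesis
    by (simp add: ideal_cong_def algebra_simps)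
qed

lemma ideal_cong_diff:
  assumes "p \<approx> q" "p' \<approx> q'"
  shows "p - p' \<approx> q - q'"
  using ideal_cong_add[OF assms(1) ideal_cong_mult[OF ideal_cong_refl[of "-1"] assms(2)]] by simp

lemma ideal_cong_sum:
  assumes "\<And>i. i \<in> A \<Longrightarrow> f i \<approx> g i"
  shows "sum f A \<approx> sum g A"
  using assms
  by (induction A rule: infinite_finite_induct) (simp_all add: ideal_cong_refl ideal_cong_add)

lemma ideal_cong_prod:
  assumes "\<And>i. i \<in> A \<Longrightarrow> f i \<approx> g i"
  shows "prod f A \<approx> prod g A"
  using assms
  by (induction A rule: infinite_finite_induct) (simp_all add: ideal_cong_refl ideal_cong_mult)

lemma stanley_sum_cong:
  assumes "\<And>b. p b \<approx> p' b" "\<And>b. m b \<approx> m' b"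
  shows "stanley_sum p m \<approx> stanley_sum p' m'"
proof -
  have "stanley_term p m J \<approx> stanley_term p' m' J" for J
    unfolding stanley_term_def using assms by (intro ideal_cong_prod) simp
  then show ?thesis
    unfolding stanley_sum_def
    by (intro ideal_cong_add ideal_cong_diff ideal_cong_mult ideal_cong_sum ideal_cong_refl)
qed

text \<open>A normal form for the variables in the hook space. The adjacency matrix of the Petersen
  graph has eigenvalue 1 with multiplicity 5, so five free variables are what remains.\<close>

fun outer_form :: "vertex \<Rightarrow> hook_poly" where
  "outer_form C3 = ell C4 - ell C2 - ell C5"
| "outer_form A3 = ell C2 - ell C4 - ell B3"
| "outer_form B2 = ell B3 - ell C2 - ell A1"
| "outer_form A2 = ell A1 - ell B3 - ell C5"
| "outer_form B1 = ell C5 - ell A1 - ell C4"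
| "outer_form b = ell b"

lemma neighbours_outer:
  "{a. a \<sim> C4} = {C2, C5, C3}"
  "{a. a \<sim> C2} = {C4, B3, A3}"
  "{a. a \<sim> B3} = {C2, A1, B2}"
  "{a. a \<sim> A1} = {B3, C5, A2}"
  "{a. a \<sim> C5} = {A1, C4, B1}"
  by (auto simp: adj_def petersen_edges_def doubleton_eq_iff)

lemma ell_cong_outer_form: "ell b \<approx> outer_form b"
proof -
  note generators = hook_ideal_generator[of C4] hook_ideal_generator[of C2]
    hook_ideal_generator[of B3] hook_ideal_generator[of A1] hook_ideal_generator[of C5]
  \<comment> \<open>For an inner vertex the difference is exactly the generator at its outer
    neighbour; for an outer vertex it is 0.\<close>
  have "outer_form b \<approx> ell b"
    using generators
    by (cases b) (simp_all add: ideal_cong_def hook_ideal_zero neighbours_outer diff_diff_eq ac_simps)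
  then show ?thesis
    by (rule ideal_cong_sym)
qed

lemma stanley_sum_hook_swap: "stanley_sum u_minus u_plus \<approx> F"
proof -
  let ?p = "\<lambda>b. outer_form b + beta" and ?m = "\<lambda>b. outer_form b - beta"
  have p: "ell b + beta \<approx> ?p b" and m: "ell b - beta \<approx> ?m b" for b
    by (intro ideal_cong_add ideal_cong_diff ell_cong_outer_form ideal_cong_refl)+
  have "stanley_sum (\<lambda>b. ell b - beta) (\<lambda>b. ell b + beta) \<approx> stanley_sum ?m ?p"
    by (intro stanley_sum_cong p m)
  also have "stanley_sum ?m ?p = stanley_sum ?p ?m"
    by (rule stanley_sum_swap[symmetric]) simp_all
  also have "stanley_sum ?p ?m \<approx> stanley_sum (\<lambda>b. ell b + beta) (\<lambda>b. ell b - beta)"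
    by (intro stanley_sum_cong ideal_cong_sym[OF p] ideal_cong_sym[OF m])
  finally (ideal_cong_trans) show ?thesis
    \<comment> \<open>The halves in the hooks come out of both sides as the common factor
      \<open>Const (1/2) ^ 10\<close>.\<close>
    unfolding F_eq_stanley_sum u_plus_def[abs_def] u_minus_def[abs_def] stanley_sum_scale
    by (rule ideal_cong_mult[OF ideal_cong_refl])
qed

section \<open>The automorphism\<close>

text \<open>A locale lets the results proved for \<open>C\<close> be applied to \<open>inv C\<close>
  as well.\<close>

locale ell_negation =
  fixes C :: "hook_poly \<Rightarrow> hook_poly"
  assumes automorphism: "ring_automorphism C"
    and ell: "C (ell b) = - ell b"
    and beta: "C beta = beta"
begin

lemma bij: "bij C"
  and one: "C 1 = 1"
  and add: "C (p + q) = C p + C q"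
  and mult: "C (p * q) = C p * C q"
  using automorphism by (simp_all add: ring_automorphism_def)

lemma zero: "C 0 = 0"
  using add[of 0 0] by simp

lemma uminus: "C (- p) = - C p"
  using add[of p "- p"] by (simp add: zero eq_neg_iff_add_eq_0 add.commute)

lemma diff: "C (p - q) = C p - C q"
  using add[of p "- q"] by (simp add: uminus)

lemma sum: "C (sum f A) = (\<Sum>i\<in>A. C (f i))"
  by (induction A rule: infinite_finite_induct) (simp_all add: zero add)

lemma prod: "C (prod f A) = (\<Prod>i\<in>A. C (f i))"
  by (induction A rule: infinite_finite_induct) (simp_all add: one mult)

lemma numeral: "C (numeral n) = numeral n"
  by (induction n) (simp_all only: numeral.simps one add)

text \<open>Linearity over the rationals is not among the assumptions on \<open>C\<close>. But
  \<open>C\<close> fixes 2, and an integral domain contains at most one inverse of 2.\<close>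

lemma half: "C (Const (1/2)) = Const (1/2)"
proof -
  have inverse: "Const (1/2) * 2 = 1"
    by (simp add: Const_def mult_single flip: single_one single_numeral)
  then have "C (Const (1/2)) * 2 = 1"
    using mult[of "Const (1/2)" 2] by (simp only: numeral one)
  with inverse have "C (Const (1/2)) * 2 = Const (1/2) * 2"
    by simp
  then show ?thesis
    by (rule mult_right_cancel[THEN iffD1, rotated]) simp
qed

lemma stanley_sum: "C (stanley_sum p m) = stanley_sum (\<lambda>b. C (p b)) (\<lambda>b. C (m b))"
  by (simp add: stanley_sum_def stanley_term_def add diff mult sum prod numeral if_distrib[of C]
      cong: if_cong)

lemma F: "C F = stanley_sum u_minus u_plus"
proof -
  have "C (u_plus b) = -1 * u_minus b" "C (u_minus b) = -1 * u_plus b" for b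
    by (simp_all add: u_plus_def u_minus_def mult add diff half ell beta algebra_simps)
  then have "C F = (-1) ^ 10 * stanley_sum u_minus u_plus"
    unfolding F_eq_stanley_sum stanley_sum by (simp only: stanley_sum_scale)
  then show ?thesis
    by simp
qed

lemma image_hook_ideal_subset: "C ` hook_ideal \<subseteq> hook_ideal"
proof
  fix q assume "q \<in> C ` hook_ideal"
  then obtain p where "p \<in> hook_ideal" and q: "q = C p"
    by blast
  from this(1) have "C p \<in> hook_ideal"
    unfolding hook_ideal_def ideal_generated_def
  proof (induction rule: ring_module.span_induct_alt)
    case base
    then show ?case
      by (simp add: zero ring_module.span_zero)
  next
    case (step r g p)
    then obtain b where "g = ell b - (\<Sum>a | a \<sim> b. ell a)"
      by blast
    \<comment> \<open>A generator is a linear form in the \<open>ell\<close> variables alone, so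
      \<open>C\<close> negates it.\<close>
    then have "C g = -1 * g"
      by (simp add: diff sum ell sum_negf)
    then have "C (r * g + p) = (- C r) * g + C p"
      by (simp add: add mult)
    with step show ?case
      by (simp only: ring_module.span_add ring_module.span_scale ring_module.span_base)
  qed
  with q show "q \<in> hook_ideal"
    by simp
qed

lemma ell_negation_inv: "ell_negation (inv C)"
proof
  have inv_eq: "inv C p = q" if "C q = p" for p q
    using that bij by (metis bij_inv_eq_iff)
  have C_inv: "C (inv C p) = p" for p
    using bij by (simp add: bij_is_surj surj_f_inv_f)
  show "ring_automorphism (inv C)"
    unfolding ring_automorphism_def using bij
    by (auto simp: bij_imp_bij_inv one add mult C_inv intro!: inv_eq)
  show "inv C (ell b) = - ell b" for b
    by (rule inv_eq) (simp add: uminus ell)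
  show "inv C beta = beta"
    by (rule inv_eq) (rule beta)
qed

lemma image_hook_ideal: "C ` hook_ideal = hook_ideal"
proof
  \<comment> \<open>The inclusion already shown, applied to \<open>inv C\<close> and then mapped by
    \<open>C\<close>, gives the reverse one.\<close>
  have "C ` inv C ` hook_ideal \<subseteq> C ` hook_ideal"
    using ell_negation.image_hook_ideal_subset[OF ell_negation_inv] by (rule image_mono)
  then show "hook_ideal \<subseteq> C ` hook_ideal"
    using bij by (simp add: bij_is_surj image_f_inv_f)
qed (rule image_hook_ideal_subset)

end

theorem mainTheorem1:
  fixes C :: "hook_poly \<Rightarrow> hook_poly"
  assumes "ring_automorphism C"
    and "\<And>b. C (ell b) = - ell b"
    and "C beta = beta"
  shows "C ` hook_ideal = hook_ideal \<and> C F - F \<in> hook_ideal"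
proof -
  interpret ell_negation C
    using assms by unfold_locales
  show ?thesis
    using image_hook_ideal stanley_sum_hook_swap by (simp add: F ideal_cong_def)
qed

end
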